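(* Let $\kappa$ be an uncountable cardinal. Then the following six statements are all equivalent: for $Q \in \{\text{some}, \text{every}\}$ and $\Gamma \in \{\text{compact}, \text{closed}, F_\sigma\}$, the statement "$Q$ uncountable Polish space can be partitioned into $\kappa$ sets of type $\Gamma$". That is, each of "some uncountable Polish space can be partitioned into $\kappa$ compact sets", "some uncountable Polish space can be partitioned into $\kappa$ closed sets", "some uncountable Polish space can be partitioned into $\kappa$ $F_\sigma$ sets", "every uncountable Polish space can be partitioned into $\kappa$ compact sets", "every uncountable Polish space can be partitioned into $\kappa$ closed sets", and "every uncountable Polish space can be partitioned into $\kappa$ $F_\sigma$ sets" is equivalent to each of the others.
   Context: A partition of a set is a family of pairwise disjoint nonempty subsets whose union is the whole set. *)

theory Defs
  imports "HOL-Analysis.Analysis" "HOL-Library.Disjoint_Sets"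
begin

unbundle cardinal_syntax

definition Polish_space :: "'a topology \<Rightarrow> bool" where
  "Polish_space X \<longleftrightarrow> separable_space X \<and> completely_metrizable_space X"

datatype set_kind = Compact | Closed | F_sigma

primrec of_kind :: "set_kind \<Rightarrow> 'a topology \<Rightarrow> 'a set \<Rightarrow> bool" where
  "of_kind Compact X S \<longleftrightarrow> compactin X S"
| "of_kind Closed X S \<longleftrightarrow> closedin X S"
| "of_kind F_sigma X S \<longleftrightarrow> fsigma_in X S"

definition can_be_partitioned :: "'a topology \<Rightarrow> 'k rel \<Rightarrow> set_kind \<Rightarrow> bool" where
  "can_be_partitioned X \<kappa> \<Gamma> \<longleftrightarrow>
     (\<exists>P. partition_on (topspace X) P \<and> |P| =o \<kappa> \<and> (\<forall>S\<in>P. of_kind \<Gamma> X S))"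

datatype quantifier = Some_space | Every_space

text \<open>
  The statement ``Q uncountable Polish space can be partitioned into \<open>\<kappa>\<close> sets of type \<open>\<Gamma>\<close>'',
  with Q ranging over the Polish spaces whose points are elements of the type
  \<open>'a\<close>. HOL cannot quantify over types inside a formula, so the type is a parameter.
  A type that is too small carries no uncountable Polish space at all, which makes the
  \<open>Some_space\<close> form false and the \<open>Every_space\<close> form vacuous; results about
  this notion should therefore assume that \<open>'a\<close> has at least continuum many elements.
  Each uncountable Polish space has exactly continuum many points, so every such type
  carries all of them up to homeomorphism.
\<close>

primrec partition_statement ::
    "'a itself \<Rightarrow> 'k rel \<Rightarrow> quantifier \<Rightarrow> set_kind \<Rightarrow> bool" where
  "partition_statement T \<kappa> Some_space \<Gamma> \<longleftrightarrow>
     (\<exists>X :: 'a topology. Polish_space X \<and> uncountable (topspace X) \<and> can_be_partitioned X \<kappa> \<Gamma>)"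
| "partition_statement T \<kappa> Every_space \<Gamma> \<longleftrightarrow>
     (\<forall>X :: 'a topology. Polish_space X \<longrightarrow> uncountable (topspace X) \<longrightarrow> can_be_partitioned X \<kappa> \<Gamma>)"

end

theory Submission
  imports Defs "HOL-Library.Countable_Set_Type"
begin

text \<open>
  Every nonempty Polish space is a continuous bijective image of a closed subset of the Baire space,
  so an F-sigma partition of some Polish space pulls back to one of the Baire space. There
  every F-sigma set is a countable disjoint union of closed sets, which gives a partition of the
  Baire space into \<open>\<kappa>\<close> closed sets.

  To get compact pieces, call a point essential if none of its neighbourhoods is covered by
  countably many pieces. Starting from an essential point one builds a tree of essential points
  in which the children of a node converge to it and have neighbourhoods avoiding its piece.
  The branches give a continuous injection \<open>\<phi>\<close> of the Baire space into itself for which the preimage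
  of a piece \<open>p\<close> is compact: if infinitely many children of a node \<open>e\<close> had branches in \<open>p\<close>, then
  \<open>e\<close> would lie in \<open>p\<close>, but these branches avoid the piece of \<open>e\<close>. So the Baire space has a partition
  into at most \<open>\<kappa>\<close> compact sets, and intersecting it with the closed partition gives exactly \<open>\<kappa>\<close>.

  For a second Polish space, coded by a closed set \<open>F\<close>, the same tree construction for
  the partition of \<open>F\<close> into points embeds the Baire space in \<open>F\<close> with an F-sigma complement.
  Transporting the compact pieces along this embedding, splitting the complement into countably many
  closed sets and cutting these with the compact partition gives \<open>\<kappa>\<close> compact pieces of \<open>F\<close>,
  whose images are compact pieces of the space.
\<close>

subsection \<open>The Baire space\<close>

text \<open>Cylinders are named by a centre and a length, not by a finite sequence. As with
  ultrametric balls, any member can serve as centre (\<open>cyl_eq\<close>).\<close>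

definition cyl :: "(nat \<Rightarrow> nat) \<Rightarrow> nat \<Rightarrow> (nat \<Rightarrow> nat) set" where
  "cyl y l = {z. \<forall>i<l. z i = y i}"

lemma in_cyl: "z \<in> cyl y l \<longleftrightarrow> (\<forall>i<l. z i = y i)"
  by (simp add: cyl_def)

lemma self_in_cyl [simp]: "y \<in> cyl y l"
  by (simp add: in_cyl)

lemma cyl_antimono: "l \<le> m \<Longrightarrow> cyl y m \<subseteq> cyl y l"
  by (auto simp: in_cyl)

lemma cyl_eq: "z \<in> cyl y l \<Longrightarrow> m \<le> l \<Longrightarrow> cyl z m = cyl y m"
  by (auto simp: in_cyl)

lemma clopen_coordinate:
  "open {z :: nat \<Rightarrow> nat. z i = k}" "closed {z :: nat \<Rightarrow> nat. z i = k}"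
proof -
  have *: "{z :: nat \<Rightarrow> nat. z i = k} = (\<lambda>z. z i) -` {k}" by auto
  show "open {z :: nat \<Rightarrow> nat. z i = k}"
    unfolding * by (rule open_vimage[OF open_discrete]) (rule continuous_on_product_coordinates)
  show "closed {z :: nat \<Rightarrow> nat. z i = k}"
    unfolding * by (rule closed_vimage[OF closed_singleton]) (rule continuous_on_product_coordinates)
qed

lemma open_cyl [simp]: "open (cyl y l)" and closed_cyl [simp]: "closed (cyl y l)"
proof -
  have *: "cyl y l = (\<Inter>i\<in>{..<l}. {z. z i = y i})" by (auto simp: in_cyl)
  show "open (cyl y l)" unfolding * by (intro open_INT ballI clopen_coordinate) simp
  show "closed (cyl y l)" unfolding * by (intro closed_INT ballI clopen_coordinate)
qed

text \<open>A basic open set of the product restricts finitely many coordinates; a bound on these is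
  the length of a cylinder inside it.\<close>

lemma open_iff_cyl: "open U \<longleftrightarrow> (\<forall>y\<in>U. \<exists>l. cyl y l \<subseteq> U)"
proof
  assume U: "open U"
  show "\<forall>y\<in>U. \<exists>l. cyl y l \<subseteq> U"
  proof
    fix y assume "y \<in> U"
    have "openin (product_topology (\<lambda>_. euclidean) UNIV) U"
      using U by (simp add: euclidean_product_topology)
    then obtain X where X: "y \<in> (\<Pi>\<^sub>E i\<in>UNIV. X i)" "finite {i. X i \<noteq> UNIV}" "(\<Pi>\<^sub>E i\<in>UNIV. X i) \<subseteq> U"
      using product_topology_open_contains_basis[of "\<lambda>_. euclidean" UNIV U y] \<open>y \<in> U\<close> by auto
    obtain l where l: "\<And>i. X i \<noteq> UNIV \<Longrightarrow> i < l"
      using finite_nat_set_iff_bounded X(2) by auto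
    have "cyl y l \<subseteq> (\<Pi>\<^sub>E i\<in>UNIV. X i)"
    proof
      fix z assume z: "z \<in> cyl y l"
      have "z i \<in> X i" for i
        using l[of i] z X(1) by (cases "X i = UNIV") (auto simp: in_cyl)
      then show "z \<in> (\<Pi>\<^sub>E i\<in>UNIV. X i)" by auto
    qed
    then show "\<exists>l. cyl y l \<subseteq> U" using X(3) by blast
  qed
next
  assume *: "\<forall>y\<in>U. \<exists>l. cyl y l \<subseteq> U"
  then obtain l where "\<And>y. y \<in> U \<Longrightarrow> cyl y (l y) \<subseteq> U" by metis
  then have "U = (\<Union>y\<in>U. cyl y (l y))" by auto
  then show "open U" by (metis open_UN open_cyl)
qed

lemma closed_separate_cyl:
  assumes "closed C" "y \<notin> C"
  obtains l where "cyl y l \<inter> C = {}"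
proof -
  have "open (- C)" using assms by auto
  then obtain l where "cyl y l \<subseteq> - C" using assms(2) open_iff_cyl by blast
  then show thesis by (intro that[of l]) blast
qed

text \<open>The centres are uncountable in number, but a cylinder is determined by the finite list
  of its first \<open>l\<close> values.\<close>

lemma countable_cylinders: "countable (range (case_prod cyl))"
proof -
  have "range (case_prod cyl) \<subseteq> range (\<lambda>s. {z. map z [0..<length s] = s})"
  proof clarify
    fix y l
    have "cyl y l = (\<lambda>s. {z. map z [0..<length s] = s}) (map y [0..<l])"
      by (auto simp: in_cyl)
    then show "cyl y l \<in> range (\<lambda>s. {z. map z [0..<length s] = s})" by blast
  qed
  then show ?thesis by (rule countable_subset) simp
qed

lemma open_imp_fsigma_Baire:
  fixes U :: "(nat \<Rightarrow> nat) set"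
  assumes "open U"
  shows "fsigma_in euclidean U"
proof -
  let ?D = "{D \<in> range (case_prod cyl). D \<subseteq> U}"
  have "U \<subseteq> \<Union>?D"
  proof
    fix y assume "y \<in> U"
    then obtain l where "cyl y l \<subseteq> U" using assms open_iff_cyl by blast
    then have "cyl y l \<in> ?D" by (auto intro: range_eqI[of _ _ "(y, l)"])
    then show "y \<in> \<Union>?D" by (rule UnionI) simp
  qed
  then have U: "U = \<Union>?D" by blast
  have "fsigma_in euclidean (\<Union>?D)"
  proof (rule fsigma_in_Union)
    show "countable ?D"
      using countable_cylinders by (rule countable_subset[rotated]) blast
  qed (auto intro!: closed_imp_fsigma_in)
  with U show ?thesis by metis
qed

lemma compact_imp_closed_Baire:
  fixes C :: "(nat \<Rightarrow> nat) set"
  assumes "compact C"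
  shows "closed C"
proof -
  have "Hausdorff_space (euclidean :: (nat \<Rightarrow> nat) topology)"
    unfolding Hausdorff_space_def
  proof clarsimp
    fix x y :: "nat \<Rightarrow> nat" assume "x \<noteq> y"
    then obtain i where i: "x i \<noteq> y i" by blast
    show "\<exists>U. open U \<and> (\<exists>V. open V \<and> x \<in> U \<and> y \<in> V \<and> disjnt U V)"
      by (intro exI[of _ "{z. z i = x i}"] exI[of _ "{z. z i = y i}"] conjI clopen_coordinate)
        (use i in \<open>auto simp: disjnt_def\<close>)
  qed
  then show ?thesis using compactin_imp_closedin[of euclidean C] assms by simp
qed

lemma fsigma_partition_closed:
  fixes S :: "(nat \<Rightarrow> nat) set"
  assumes "fsigma_in euclidean S"
  obtains \<C> where "countable \<C>" "partition_on S \<C>" "\<And>C. C \<in> \<C> \<Longrightarrow> closed C"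
proof -
  obtain C :: "nat \<Rightarrow> _" where C': "\<forall>n. closedin euclidean (C n)" and S: "(\<Union>n. C n) = S"
    using assms unfolding fsigma_in_ascending by blast
  have C: "closed (C n)" for n using C' by simp
  \<comment> \<open>Of the points of \<open>C k\<close> that lie in no earlier set, collect those with the same maximal cylinder
    inside the open complement of the earlier sets.\<close>
  define n where "n y = (LEAST n. y \<in> C n)" for y
  define V where "V k = - (\<Union>m<k. C m)" for k
  define l where "l y = (LEAST l. cyl y l \<subseteq> V (n y))" for y
  define piece where "piece y = C (n y) \<inter> cyl y (l y)" for y
  have n: "y \<in> C (n y)" "y \<in> V (n y)" if "y \<in> S" for y
  proof -
    show "y \<in> C (n y)" unfolding n_def by (rule LeastI_ex) (use that S in auto)
    show "y \<in> V (n y)" unfolding V_def n_def by (auto dest: not_less_Least)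
  qed
  have V: "open (V k)" for k unfolding V_def using C by (intro open_Compl closed_UN) auto
  have l: "cyl y (l y) \<subseteq> V (n y)" if "y \<in> S" for y
    unfolding l_def by (rule LeastI_ex) (use open_iff_cyl[THEN iffD1, OF V] n(2)[OF that] in blast)
  \<comment> \<open>A member \<open>z\<close> of the piece of \<open>y\<close> lies in
    \<open>C (n y)\<close> but in no earlier set, and cylinders of length at most \<open>l y\<close>
    around \<open>z\<close> and \<open>y\<close> coincide. So \<open>n\<close> and \<open>l\<close>
    are constant on a piece, and pieces are equal or disjoint.\<close>
  have eq: "piece z = piece y" if y: "y \<in> S" and z: "z \<in> piece y" for y z
  proof -
    have zV: "z \<in> V (n y)" "z \<in> C (n y)" using l[OF y] z by (auto simp: piece_def)
    have nz: "n z = n y"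
    proof -
      have "n z \<le> n y" unfolding n_def[of z] using zV(2) by (rule Least_le)
      moreover have "z \<in> C (n z)" using n(1)[of z] zV(2) S by blast
      then have "\<not> n z < n y" using zV(1) unfolding V_def by blast
      ultimately show ?thesis by simp
    qed
    have zc: "z \<in> cyl y (l y)" using z by (simp add: piece_def)
    have lz: "l z = l y"
      unfolding l_def[of z] nz
    proof (rule Least_equality)
      show "cyl z (l y) \<subseteq> V (n y)" using cyl_eq[OF zc order_refl] l[OF y] by simp
      fix m assume m: "cyl z m \<subseteq> V (n y)"
      show "l y \<le> m"
      proof (rule ccontr)
        assume "\<not> l y \<le> m"
        then have "cyl y m \<subseteq> V (n y)" using cyl_eq[OF zc, of m] m by auto
        then have "l y \<le> m" unfolding l_def by (rule Least_le)
        with \<open>\<not> l y \<le> m\<close> show False by simp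
      qed
    qed
    show ?thesis unfolding piece_def nz lz using cyl_eq[OF zc order_refl] by simp
  qed
  have self: "y \<in> piece y" if "y \<in> S" for y using n(1)[OF that] by (simp add: piece_def)
  have sub: "piece y \<subseteq> S" for y using S by (auto simp: piece_def)
  show thesis
  proof
    have "piece ` S \<subseteq> (\<lambda>(k, D). C k \<inter> D) ` (UNIV \<times> range (case_prod cyl))"
      unfolding piece_def by (auto intro!: image_eqI[of _ _ "(n y, cyl y (l y))" for y])
    then show "countable (piece ` S)"
      by (rule countable_subset) (intro countable_image countable_SIGMA countable_cylinders countableI_type)
    show "partition_on S (piece ` S)"
    proof (rule partition_onI)
      show "\<Union> (piece ` S) = S" using self sub by blast
      show "{} \<notin> piece ` S" using self by auto
      show "disjnt p q" if pq: "p \<in> piece ` S" "q \<in> piece ` S" "p \<noteq> q" for p q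
      proof -
        obtain y z where "y \<in> S" "z \<in> S" "p = piece y" "q = piece z" using pq by blast
        then show ?thesis using pq(3) eq[of y] eq[of z] unfolding disjnt_def by blast
      qed
    qed
    show "closed D" if "D \<in> piece ` S" for D using that C by (auto simp: piece_def)
  qed
qed

subsection \<open>A tree of essential points\<close>

text \<open>
  \<open>N e\<close> is the set to be avoided by the children of the node \<open>e\<close>, and \<open>c e m\<close> is the point chosen in the
  cylinder of length \<open>m\<close> around \<open>e\<close>. Nodes are indexed by a branch \<open>x\<close> and a depth \<open>n\<close>, and depend only
  on the first \<open>n\<close> entries of \<open>x\<close>. Iterating \<open>r e\<close> yields the lengths at which the children of \<open>e\<close>
  split off from \<open>e\<close>, so that they have disjoint neighbourhoods.
\<close>

locale baire_scheme =
  fixes A :: "(nat \<Rightarrow> nat) set" and N :: "(nat \<Rightarrow> nat) \<Rightarrow> (nat \<Rightarrow> nat) set"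
    and c :: "(nat \<Rightarrow> nat) \<Rightarrow> nat \<Rightarrow> nat \<Rightarrow> nat" and r :: "(nat \<Rightarrow> nat) \<Rightarrow> nat \<Rightarrow> nat"
    and a :: "nat \<Rightarrow> nat"
  assumes root: "a \<in> A"
    and self: "e \<in> A \<Longrightarrow> e \<in> N e"
    and c_A: "e \<in> A \<Longrightarrow> c e m \<in> A"
    and c_cyl: "e \<in> A \<Longrightarrow> c e m \<in> cyl e m"
    and r_gt: "e \<in> A \<Longrightarrow> m < r e m"
    and avoid: "e \<in> A \<Longrightarrow> cyl (c e m) (r e m) \<inter> N e = {}"
begin

primrec node :: "(nat \<Rightarrow> nat) \<Rightarrow> nat \<Rightarrow> (nat \<Rightarrow> nat) \<times> nat" where
  "node x 0 = (a, 0)"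
| "node x (Suc n) =
     (let e = fst (node x n); m = (r e ^^ x n) (snd (node x n)) in (c e m, r e m))"

definition "pt x n = fst (node x n)"
definition "len x n = snd (node x n)"
definition "split x n = (r (pt x n) ^^ x n) (len x n)"
definition "nbhd x n = cyl (pt x n) (len x n)"
text \<open>Diagonal choice: neighbourhoods at depth \<open>Suc i\<close> have length at least
  \<open>Suc i\<close>, so coordinate \<open>i\<close> is fixed from that depth on.\<close>

definition "limit_pt x i = pt x (Suc i) i"

section \<open>Lengths and neighbourhoods along a branch\<close>

lemma pt_Suc: "pt x (Suc n) = c (pt x n) (split x n)"
  and len_Suc: "len x (Suc n) = r (pt x n) (split x n)"
  by (simp_all add: pt_def len_def split_def Let_def)

lemma pt_A: "pt x n \<in> A"
  by (induction n) (simp_all add: pt_Suc c_A, simp add: pt_def root)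

lemma funpow_r_ge: "e \<in> A \<Longrightarrow> l + k \<le> (r e ^^ k) l"
proof (induction k)
  case (Suc k)
  then show ?case using r_gt[of e "(r e ^^ k) l"] by simp
qed simp

text \<open>Strict growth of the iterates makes a later splitting length at least the neighbourhood
  length of an earlier child, which keeps siblings apart.\<close>

lemma funpow_r_less:
  assumes "e \<in> A" "k < k'"
  shows "r e ((r e ^^ k) l) \<le> (r e ^^ k') l"
proof -
  have "strict_mono (\<lambda>k. (r e ^^ k) l)"
    using r_gt[OF assms(1)] by (simp add: strict_mono_Suc_iff)
  then have "(r e ^^ Suc k) l \<le> (r e ^^ k') l"
    using assms(2) by (metis Suc_leI strict_mono_less_eq)
  then show ?thesis by simp
qed

lemma split_ge: "len x n + x n \<le> split x n"
  unfolding split_def by (rule funpow_r_ge[OF pt_A])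

lemma len_less: "len x n < len x (Suc n)"
  using split_ge[of x n] r_gt[OF pt_A, of "split x n" x n] by (simp add: len_Suc)

lemma len_ge: "n \<le> len x n"
proof (induction n)
  case (Suc n)
  then show ?case using len_less[of x n] by linarith
qed simp

text \<open>The child lies in this cylinder and has a longer neighbourhood. By
  \<open>split_ge\<close>, children of large index are therefore close to their parent.\<close>

lemma nbhd_Suc_sub_cyl: "nbhd x (Suc n) \<subseteq> cyl (pt x n) (split x n)"
proof -
  have "cyl (pt x (Suc n)) (len x (Suc n)) \<subseteq> cyl (pt x (Suc n)) (split x n)"
    using r_gt[OF pt_A] by (intro cyl_antimono) (simp add: len_Suc less_imp_le)
  then show ?thesis
    unfolding nbhd_def using cyl_eq[OF c_cyl[OF pt_A] order_refl] by (simp add: pt_Suc)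
qed

lemma nbhd_antimono: "n \<le> m \<Longrightarrow> nbhd x m \<subseteq> nbhd x n"
proof (induction rule: dec_induct)
  case (step m)
  have "cyl (pt x m) (split x m) \<subseteq> nbhd x m"
    unfolding nbhd_def using split_ge[of x m] by (intro cyl_antimono) simp
  then show ?case using nbhd_Suc_sub_cyl step by blast
qed simp

lemma nbhd_avoid: "nbhd x (Suc n) \<inter> N (pt x n) = {}"
  unfolding nbhd_def len_Suc pt_Suc by (rule avoid[OF pt_A])

lemma node_cong: "(\<And>i. i < n \<Longrightarrow> x i = y i) \<Longrightarrow> node x n = node y n"
  by (induction n) (simp_all add: Let_def)

lemma nbhd_cong: "(\<And>i. i < n \<Longrightarrow> x i = y i) \<Longrightarrow> nbhd x n = nbhd y n"
  using node_cong[of n x y] by (simp add: nbhd_def pt_def len_def)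

text \<open>The later sibling stays in the cylinder around the parent whose length is that of the
  earlier sibling's neighbourhood. A common point would make the two equal, so that the
  neighbourhood would contain the parent; but the parent lies in the set it avoids.\<close>

lemma nbhd_disjoint_less:
  assumes "\<And>i. i < n \<Longrightarrow> x i = y i" "x n < y n"
  shows "nbhd x (Suc n) \<inter> nbhd y (Suc n) = {}"
proof -
  have eq: "pt y n = pt x n" "len y n = len x n"
    using node_cong[OF assms(1)] by (simp_all add: pt_def len_def)
  have le: "len x (Suc n) \<le> split y n"
    unfolding len_Suc split_def eq using funpow_r_less[OF pt_A assms(2)] .
  then have y: "nbhd y (Suc n) \<subseteq> cyl (pt x n) (len x (Suc n))"
    using nbhd_Suc_sub_cyl[of y n] cyl_antimono[OF le, of "pt x n"] by (simp add: eq)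
  have pt: "pt x n \<notin> nbhd x (Suc n)" using self[OF pt_A, of x n] nbhd_avoid[of x n] by blast
  have "z \<notin> nbhd y (Suc n)" if z: "z \<in> nbhd x (Suc n)" for z
  proof
    assume "z \<in> nbhd y (Suc n)"
    then have "cyl z (len x (Suc n)) = cyl (pt x n) (len x (Suc n))"
      using y by (intro cyl_eq) auto
    moreover have "cyl z (len x (Suc n)) = nbhd x (Suc n)"
      using z unfolding nbhd_def by (intro cyl_eq) auto
    ultimately show False using pt by simp
  qed
  then show ?thesis by blast
qed

text \<open>At the first disagreement of two branches their neighbourhoods become disjoint.\<close>

lemma nbhd_same:
  assumes "z \<in> nbhd x n" "z \<in> nbhd y n" "i < n"
  shows "x i = y i"
proof (rule ccontr)
  define j where "j = (LEAST j. x j \<noteq> y j)"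
  assume neq: "x i \<noteq> y i"
  then have j: "x j \<noteq> y j" "j \<le> i" unfolding j_def by (rule LeastI, rule Least_le)
  have eq: "x k = y k" if "k < j" for k
    using not_less_Least[OF that[unfolded j_def]] by simp
  have "nbhd x (Suc j) \<inter> nbhd y (Suc j) = {}"
  proof (cases "x j < y j")
    case True
    show ?thesis by (rule nbhd_disjoint_less[of j x y, OF eq True])
  next
    case False
    then have "y j < x j" using j(1) by simp
    have "nbhd y (Suc j) \<inter> nbhd x (Suc j) = {}"
      by (rule nbhd_disjoint_less[of j y x, OF eq[symmetric] \<open>y j < x j\<close>])
    then show ?thesis by blast
  qed
  moreover have "Suc j \<le> n" using j assms(3) by simp
  ultimately show False using assms(1,2) nbhd_antimono[of "Suc j" n x] nbhd_antimono[of "Suc j" n y] by blast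
qed

section \<open>The limit map, its range and its preimages\<close>

lemma limit_pt_nbhd: "limit_pt x \<in> nbhd x n"
proof -
  have pt: "pt x m \<in> nbhd x k" if "k \<le> m" for m k
    using nbhd_antimono[OF that] unfolding nbhd_def by fastforce
  have "pt x (Suc i) i = pt x n i" if "i < len x n" for i
  proof (cases "n \<le> Suc i")
    case True
    then show ?thesis using pt[OF True] that by (simp add: nbhd_def in_cyl)
  next
    case False
    then have "pt x n \<in> nbhd x (Suc i)" by (intro pt) simp
    then show ?thesis using len_ge[of "Suc i" x] by (simp add: nbhd_def in_cyl)
  qed
  then show ?thesis by (simp add: nbhd_def in_cyl limit_pt_def)
qed

lemma limit_pt_unique:
  assumes "\<And>n. z \<in> nbhd x n" shows "z = limit_pt x"
proof
  fix i
  show "z i = limit_pt x i"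
    using assms[of "Suc i"] len_ge[of "Suc i" x] by (simp add: nbhd_def in_cyl limit_pt_def)
qed

lemma nbhd_agree: "z \<in> nbhd x n \<Longrightarrow> z' \<in> nbhd x n \<Longrightarrow> z \<in> cyl z' n"
  using len_ge[of n x] by (auto simp: nbhd_def in_cyl)

lemma continuous_limit_pt: "continuous_on UNIV limit_pt"
  unfolding continuous_on_open_vimage[OF open_UNIV]
proof clarsimp
  fix V :: "(nat \<Rightarrow> nat) set" assume V: "open V"
  show "open (limit_pt -` V)"
    unfolding open_iff_cyl[of "limit_pt -` V"]
  proof
    fix x assume "x \<in> limit_pt -` V"
    then obtain l where l: "cyl (limit_pt x) l \<subseteq> V" using V open_iff_cyl by auto
    have "limit_pt y \<in> V" if "y \<in> cyl x l" for y
    proof -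
      have "limit_pt y \<in> nbhd x l"
        using nbhd_cong[of l y x] that limit_pt_nbhd[of y l] by (simp add: in_cyl)
      then show ?thesis using nbhd_agree[OF _ limit_pt_nbhd] l by blast
    qed
    then show "\<exists>l. cyl x l \<subseteq> limit_pt -` V" by blast
  qed
qed

lemma inj_limit_pt: "inj limit_pt"
proof (rule injI, rule ext)
  fix x y i assume "limit_pt x = limit_pt y"
  then show "x i = y i"
    using nbhd_same[OF limit_pt_nbhd[of x "Suc i"], of y i] limit_pt_nbhd[of y "Suc i"] by simp
qed

lemma limit_pt_closed:
  assumes "closed F" "A \<subseteq> F" shows "limit_pt x \<in> F"
proof (rule ccontr)
  assume "limit_pt x \<notin> F"
  then obtain l where l: "cyl (limit_pt x) l \<inter> F = {}" using assms(1) closed_separate_cyl by blast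
  have "pt x l \<in> cyl (limit_pt x) l"
    by (rule nbhd_agree[OF _ limit_pt_nbhd]) (simp add: nbhd_def)
  then show False using l pt_A assms(2) by blast
qed

text \<open>A point in every level picks a prefix at each depth; since neighbourhoods of different
  prefixes are disjoint, these prefixes fit together to one branch.\<close>

lemma range_limit_pt: "range limit_pt = (\<Inter>n. \<Union>x. nbhd x n)"
proof
  show "range limit_pt \<subseteq> (\<Inter>n. \<Union>x. nbhd x n)" using limit_pt_nbhd by blast
  show "(\<Inter>n. \<Union>x. nbhd x n) \<subseteq> range limit_pt"
  proof
    fix z assume "z \<in> (\<Inter>n. \<Union>x. nbhd x n)"
    then have "\<forall>n. \<exists>x. z \<in> nbhd x n" by blast
    then obtain w where w: "\<And>n. z \<in> nbhd (w n) n" by metis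
    define x where "x i = w (Suc i) i" for i
    have eq: "w n i = x i" if "i < n" for i n
    proof -
      have "z \<in> nbhd (w n) (Suc i)" using w[of n] nbhd_antimono[of "Suc i" n "w n"] that by auto
      then show ?thesis using nbhd_same[OF _ w[of "Suc i"], of "w n" i] by (simp add: x_def)
    qed
    have "z \<in> nbhd x n" for n using w[of n] nbhd_cong[of n "w n" x] eq by simp
    then show "z \<in> range limit_pt" using limit_pt_unique by blast
  qed
qed

lemma fsigma_compl_range: "fsigma_in euclidean (- range limit_pt)"
proof -
  have "- range limit_pt = \<Union> (range (\<lambda>n. - (\<Union>x. nbhd x n)))" unfolding range_limit_pt by blast
  moreover have "closed (- (\<Union>x. nbhd x n))" for n
    unfolding nbhd_def by (intro closed_Compl open_UN ballI open_cyl)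
  then have "fsigma_in euclidean (\<Union> (range (\<lambda>n. - (\<Union>x. nbhd x n))))"
    by (intro fsigma_in_Union) (auto intro!: closed_imp_fsigma_in)
  ultimately show ?thesis by simp
qed

text \<open>The prefixes of branches mapped into \<open>p\<close> form a finitely branching tree, so
  the closed preimage lies in a product of finite sets, compact by Tychonoff.\<close>

lemma compact_vimage_limit_pt:
  assumes p: "closed p" and pN: "\<And>e. e \<in> A \<Longrightarrow> e \<in> p \<Longrightarrow> p \<subseteq> N e"
  shows "compact (limit_pt -` p)"
proof -
  define Q where "Q = limit_pt -` p"
  \<comment> \<open>If the node lies in \<open>p\<close>, no branch in \<open>Q\<close> passes
    through it, as its children avoid a superset of \<open>p\<close>. Otherwise some cylinder around
    it misses \<open>p\<close>, and this contains the neighbourhoods of all children of index at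
    least its length \<open>j\<close>.\<close>
  have bd: "\<exists>j. \<forall>y\<in>Q. (\<forall>i<n. y i = x i) \<longrightarrow> y n < j" for x n
  proof (cases "pt x n \<in> p")
    case True
    have "y \<notin> Q" if "\<forall>i<n. y i = x i" for y
    proof -
      have "pt y n = pt x n" using node_cong[of n y x] that by (simp add: pt_def)
      then have "p \<inter> nbhd y (Suc n) = {}" using nbhd_avoid[of y n] pN[OF pt_A True] by auto
      then show ?thesis using limit_pt_nbhd[of y "Suc n"] by (auto simp: Q_def)
    qed
    then show ?thesis by blast
  next
    case False
    then obtain j where j: "cyl (pt x n) j \<inter> p = {}" using p closed_separate_cyl by blast
    have "y n < j" if y: "y \<in> Q" "\<forall>i<n. y i = x i" for y
    proof (rule ccontr)
      assume "\<not> y n < j"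
      then have le: "j \<le> split y n" using split_ge[of y n] by simp
      have "pt y n = pt x n" using node_cong[of n y x] y(2) by (simp add: pt_def)
      then have "nbhd y (Suc n) \<subseteq> cyl (pt x n) j"
        using nbhd_Suc_sub_cyl[of y n] cyl_antimono[OF le, of "pt x n"] by simp
      then show False using j limit_pt_nbhd[of y "Suc n"] y(1) by (auto simp: Q_def)
    qed
    then show ?thesis by blast
  qed
  have fin: "finite ((\<lambda>y. map y [0..<n]) ` Q)" for n
  proof (induction n)
    case (Suc n)
    obtain j where j: "\<And>x y. y \<in> Q \<Longrightarrow> (\<forall>i<n. y i = x i) \<Longrightarrow> y n < j (x :: nat \<Rightarrow> nat)"
      using bd[of n] by metis
    have "(\<lambda>y. map y [0..<Suc n]) ` Q \<subseteq>
      (\<Union>s\<in>(\<lambda>y. map y [0..<n]) ` Q. (\<lambda>k. s @ [k]) ` {..<j (\<lambda>i. s ! i)})"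
      using j by fastforce
    then show ?case by (rule finite_subset) (intro finite_UN_I[OF Suc.IH] finite_imageI finite_lessThan)
  qed (simp add: image_constant_conv)
  have "finite ((\<lambda>y. y n) ` Q)" for n
  proof -
    have "(\<lambda>y. y n) ` Q = last ` (\<lambda>y. map y [0..<Suc n]) ` Q" by (simp add: image_image)
    then show ?thesis by (simp only:) (intro finite_imageI fin)
  qed
  then have "compactin (product_topology (\<lambda>_. euclidean) UNIV) (\<Pi>\<^sub>E n\<in>UNIV. (\<lambda>y. y n) ` Q)"
    by (simp add: compactin_PiE finite_imp_compact)
  then have "compact (\<Pi>\<^sub>E n\<in>UNIV. (\<lambda>y. y n) ` Q)"
    by (simp add: euclidean_product_topology)
  moreover have "closed Q"
    unfolding Q_def by (rule closed_vimage[OF p continuous_limit_pt])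
  moreover have "Q \<subseteq> (\<Pi>\<^sub>E n\<in>UNIV. (\<lambda>y. y n) ` Q)" by auto
  ultimately show ?thesis unfolding Q_def[symmetric] by (metis compact_Int_closed inf.absorb2)
qed

end

text \<open>The essential points \<open>A\<close> are an analogue of the perfect kernel, with
  "countable" replaced by "covered by countably many pieces". The result serves twice: for a given
  partition, to get compact preimages, and for the partition into points, to get an
  embedding.\<close>

lemma ex_condensing_embedding:
  fixes F :: "(nat \<Rightarrow> nat) set"
  assumes F: "closed F" and P: "partition_on F P" and cl: "\<And>p. p \<in> P \<Longrightarrow> closed p"
    and unc: "uncountable P"
  obtains \<phi> :: "(nat \<Rightarrow> nat) \<Rightarrow> nat \<Rightarrow> nat"
  where "continuous_on UNIV \<phi>" "inj \<phi>" "range \<phi> \<subseteq> F" "fsigma_in euclidean (F - range \<phi>)"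
    "\<And>p. p \<in> P \<Longrightarrow> compact (\<phi> -` p)"
proof -
  define small where "small S \<longleftrightarrow> (\<exists>C\<subseteq>P. countable C \<and> S \<subseteq> \<Union>C)" for S
  define A where "A = {x\<in>F. \<forall>l. \<not> small (cyl x l \<inter> F)}"
  define N where "N e = \<Union>{p\<in>P. e \<in> p}" for e
  have cov: "\<exists>p\<in>P. e \<in> p" if "e \<in> F" for e using that partition_onD1[OF P] by auto
  have N: "N e = p" if "p \<in> P" "e \<in> p" for e p
  proof -
    have "{p\<in>P. e \<in> p} = {p}" using that partition_onD2[OF P] unfolding disjoint_def by blast
    then show ?thesis by (simp add: N_def)
  qed
  have small_mono: "small T" if "small S" "T \<subseteq> S" for S T
    using that unfolding small_def by (meson subset_trans)
  have small_UN: "small (\<Union>\<S>)" if count: "countable \<S>" and sm: "\<And>S. S \<in> \<S> \<Longrightarrow> small S" for \<S>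
  proof -
    obtain C where "\<And>S. S \<in> \<S> \<Longrightarrow> C S \<subseteq> P \<and> countable (C S) \<and> S \<subseteq> \<Union> (C S)"
      using sm unfolding small_def by metis
    then show ?thesis unfolding small_def using count
      by (intro exI[of _ "\<Union>(C ` \<S>)"]) (auto, blast)
  qed
  have rest: "small (F - A)"
  proof -
    let ?\<S> = "{D \<inter> F | D. D \<in> range (case_prod cyl) \<and> small (D \<inter> F)}"
    have "?\<S> \<subseteq> (\<lambda>D. D \<inter> F) ` range (case_prod cyl)" by auto
    then have "countable ?\<S>"
      by (rule countable_subset) (intro countable_image countable_cylinders)
    then have "small (\<Union>?\<S>)" by (rule small_UN) auto
    moreover have "F - A \<subseteq> \<Union>?\<S>"
    proof
      fix x assume x: "x \<in> F - A"
      then obtain l where "small (cyl x l \<inter> F)" by (auto simp: A_def)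
      moreover have "cyl x l \<in> range (case_prod cyl)" by (rule range_eqI[of _ _ "(x, l)"]) simp
      ultimately have "cyl x l \<inter> F \<in> ?\<S>"
        unfolding mem_Collect_eq by (intro exI[of _ "cyl x l"] conjI refl)
      then show "x \<in> \<Union>?\<S>" by (rule UnionI) (use x in simp)
    qed
    ultimately show ?thesis by (rule small_mono)
  qed
  \<comment> \<open>Pieces are nonempty and disjoint, so only \<open>P\<close> itself covers
    \<open>F\<close>, and \<open>P\<close> is uncountable.\<close>
  have "\<not> small F"
  proof
    assume "small F"
    then obtain C where C: "C \<subseteq> P" "countable C" "F \<subseteq> \<Union>C" by (auto simp: small_def)
    have "P \<subseteq> C"
    proof
      fix p assume p: "p \<in> P"
      then obtain x where x: "x \<in> p" using partition_onD3[OF P] by fastforce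
      then obtain q where "q \<in> C" "x \<in> q" using C(3) p partition_onD1[OF P] by blast
      then show "p \<in> C" using N x p C(1) by blast
    qed
    then show False using unc C(2) countable_subset by blast
  qed
  then have "A \<noteq> {}" using rest by (metis Diff_empty)
  then obtain a where a: "a \<in> A" by blast
  have "\<exists>e' l. e' \<in> A \<and> e' \<in> cyl e m \<and> m < l \<and> cyl e' l \<inter> N e = {}" if e: "e \<in> A" for e m
  proof -
    obtain p where p: "p \<in> P" "e \<in> p" using e cov by (auto simp: A_def)
    \<comment> \<open>Otherwise the trace of the cylinder on \<open>F\<close> would be covered by
      \<open>p\<close> and the inessential points, hence small, although \<open>e\<close> is
      essential.\<close>
    have "\<exists>e'\<in>A. e' \<in> cyl e m \<and> e' \<notin> p"
    proof (rule ccontr)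
      assume "\<not> ?thesis"
      then have "cyl e m \<inter> F \<subseteq> \<Union>{p, F - A}" by auto
      moreover have "small (\<Union>{p, F - A})"
      proof (rule small_UN)
        have "small p" unfolding small_def using p by (intro exI[of _ "{p}"]) auto
        then show "small S" if "S \<in> {p, F - A}" for S using that rest by auto
      qed simp
      ultimately have "small (cyl e m \<inter> F)" using small_mono by blast
      then show False using e by (auto simp: A_def)
    qed
    then obtain e' where e': "e' \<in> A" "e' \<in> cyl e m" "e' \<notin> p" by blast
    then obtain l where "cyl e' l \<inter> p = {}" using cl[OF p(1)] closed_separate_cyl by blast
    \<comment> \<open>\<open>Suc m\<close> secures the strict growth \<open>r_gt\<close>; enlarging
      the length only shrinks the cylinder.\<close>
    then have "cyl e' (max l (Suc m)) \<inter> N e = {}"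
      using cyl_antimono[of l "max l (Suc m)" e'] N[OF p] by auto
    then show ?thesis using e' by (intro exI[of _ e'] exI[of _ "max l (Suc m)"]) auto
  qed
  then obtain c r where cr: "\<And>e m. e \<in> A \<Longrightarrow>
      c e m \<in> A \<and> c e m \<in> cyl e m \<and> m < r e m \<and> cyl (c e m) (r e m) \<inter> N e = {}"
    by metis
  interpret baire_scheme A N c r a
  proof
    show "e \<in> N e" if "e \<in> A" for e using that cov N by (auto simp: A_def)
  qed (use a cr in auto)
  show thesis
  proof
    show rng: "range limit_pt \<subseteq> F" using limit_pt_closed[OF F] by (auto simp: A_def)
    have "fsigma_in euclidean (F \<inter> - range limit_pt)"
      by (rule fsigma_in_Int[OF closed_imp_fsigma_in fsigma_compl_range]) (use F in simp)
    then show "fsigma_in euclidean (F - range limit_pt)" by (simp add: Diff_eq)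
    show "compact (limit_pt -` p)" if "p \<in> P" for p
      by (rule compact_vimage_limit_pt[OF cl[OF that]]) (use N that in auto)
  qed (rule continuous_limit_pt inj_limit_pt)+
qed

subsection \<open>Coding Polish spaces by closed sets\<close>

text \<open>
  Membership in each \<open>Z n\<close> and the first \<open>Z (W n k)\<close> witnessing non-membership are
  recorded. The witnesses make the set of codes closed, since both \<open>y \<in> Z n\<close> and \<open>y \<notin> Z n\<close>
  then persist in the limit.
\<close>

lemma (in Metric_space) ex_coding:
  fixes Z :: "nat \<Rightarrow> 'a set" and W :: "nat \<Rightarrow> nat \<Rightarrow> nat"
  assumes complete: mcomplete
    and closed_Z: "\<And>n. closedin mtopology (Z n)"
    and cover: "\<And>n. M \<subseteq> Z n \<union> (\<Union>k. Z (W n k))"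
    and disjoint_Z: "\<And>n k. Z n \<inter> Z (W n k) = {}"
    and small: "\<And>\<epsilon>. \<epsilon> > 0 \<Longrightarrow> \<exists>n. Z n = {} \<and> (\<forall>k. \<forall>y\<in>Z (W n k). \<forall>y'\<in>Z (W n k). d y y' < \<epsilon>)"
  obtains F :: "(nat \<Rightarrow> nat) set" and h
  where "closed F" "continuous_map (top_of_set F) mtopology h" "bij_betw h F M"
proof -
  define g where "g y n = (if y \<in> Z n then 0 else Suc (LEAST k. y \<in> Z (W n k)))" for y n
  have g0: "y \<in> Z n" if "g y n = 0" for y n
    using that by (simp add: g_def split: if_splits)
  have gSuc: "y \<in> Z (W n k)" if "y \<in> M" "g y n = Suc k" for y n k
  proof -
    have "y \<notin> Z n" "k = (LEAST k. y \<in> Z (W n k))"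
      using that(2) by (simp_all add: g_def split: if_splits)
    moreover from this have "\<exists>k. y \<in> Z (W n k)" using cover[of n] that(1) by blast
    ultimately show ?thesis by (simp only:) (rule LeastI_ex)
  qed
  \<comment> \<open>At an index with empty \<open>Z n\<close> every code value is a
    \<open>Suc\<close>, and it names a set whose points are pairwise closer than
    \<open>\<epsilon>\<close>.\<close>
  have near: "\<exists>n. \<forall>y\<in>M. \<forall>y'\<in>M. g y n = g y' n \<longrightarrow> d y y' < \<epsilon>" if pos: "\<epsilon> > 0" for \<epsilon>
  proof -
    obtain n where n: "Z n = {}" "\<And>k y y'. y \<in> Z (W n k) \<Longrightarrow> y' \<in> Z (W n k) \<Longrightarrow> d y y' < \<epsilon>"
      using small[OF pos] by blast
    have "d y y' < \<epsilon>" if y: "y \<in> M" "y' \<in> M" "g y n = g y' n" for y y'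
    proof -
      obtain k where k: "g y n = Suc k" using n(1) by (simp add: g_def)
      then show ?thesis using n(2) gSuc y by metis
    qed
    then show ?thesis by blast
  qed
  \<comment> \<open>This yields both that the set of codes is closed and that decoding is
    continuous. Convergent codes eventually agree at each index, so by \<open>near\<close> the
    points form a Cauchy sequence.\<close>
  have lim: "\<exists>y. limitin mtopology X y sequentially \<and> y \<in> M \<and> g y = x"
    if X: "\<And>j. X j \<in> M" and x: "(\<lambda>j. g (X j)) \<longlonglongrightarrow> x" for X x
  proof -
    have ev: "\<forall>\<^sub>F j in sequentially. g (X j) n = x n" for n
      using topological_tendstoD[OF x clopen_coordinate(1)[of n "x n"]] by simp
    have "MCauchy X"
      unfolding MCauchy_def
    proof (intro conjI allI impI)
      show "range X \<subseteq> M" using X by blast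
      fix \<epsilon> :: real assume "\<epsilon> > 0"
      then obtain n where n: "\<And>y y'. y \<in> M \<Longrightarrow> y' \<in> M \<Longrightarrow> g y n = g y' n \<Longrightarrow> d y y' < \<epsilon>"
        using near by blast
      obtain K where K: "\<And>j. j \<ge> K \<Longrightarrow> g (X j) n = x n"
        using ev[of n] unfolding eventually_sequentially by blast
      show "\<exists>K. \<forall>j j'. K \<le> j \<longrightarrow> K \<le> j' \<longrightarrow> d (X j) (X j') < \<epsilon>"
        by (intro exI[of _ K] allI impI n X) (simp add: K)
    qed
    then obtain y where y: "limitin mtopology X y sequentially"
      using complete unfolding mcomplete_def by blast
    have yM: "y \<in> M" using y limitin_mspace by blast
    have ycl: "y \<in> C" if "closedin mtopology C" "\<forall>\<^sub>F j in sequentially. X j \<in> C" for C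
      by (rule limitin_closedin[OF y that]) simp
    have zero: "y \<in> Z n" if "x n = 0" for n
    proof (rule ycl[OF closed_Z])
      show "\<forall>\<^sub>F j in sequentially. X j \<in> Z n"
        using ev[of n] by eventually_elim (use g0 that in auto)
    qed
    have suc: "y \<in> Z (W n k)" if "x n = Suc k" for n k
    proof (rule ycl[OF closed_Z])
      show "\<forall>\<^sub>F j in sequentially. X j \<in> Z (W n k)"
        using ev[of n] by eventually_elim (use gSuc X that in auto)
    qed
    have iff: "y \<in> Z n \<longleftrightarrow> x n = 0" for n
      using zero[of n] suc[of n "x n - 1"] disjoint_Z[of n "x n - 1"] by (cases "x n") auto
    have "g y n = x n" for n
    proof (cases "x n")
      case 0
      then show ?thesis using iff by (simp add: g_def)
    next
      case (Suc k)
      have "(LEAST k. y \<in> Z (W n k)) = k"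
      proof (rule Least_equality)
        show "y \<in> Z (W n k)" by (rule suc[OF Suc])
        \<comment> \<open>An earlier witness \<open>k'\<close> would make \<open>x\<close> vanish at
          \<open>W n k'\<close>, so that \<open>X j\<close> would eventually lie in
          \<open>Z (W n k')\<close>, against the minimality recorded in
          \<open>g (X j) n\<close>.\<close>
        fix k' assume k': "y \<in> Z (W n k')"
        show "k \<le> k'"
        proof (rule ccontr)
          assume "\<not> k \<le> k'"
          have "\<forall>\<^sub>F j in sequentially. g (X j) n = Suc k \<and> g (X j) (W n k') = x (W n k')"
            using ev[of n] ev[of "W n k'"] by eventually_elim (simp add: Suc)
          then obtain j where j: "g (X j) n = Suc k" "g (X j) (W n k') = x (W n k')"
            using eventually_happens by force
          have "x (W n k') = 0" using k' iff by blast
          then have "X j \<in> Z (W n k')" using j(2) g0 by simp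
          then have "(LEAST k. X j \<in> Z (W n k)) \<le> k'" by (rule Least_le)
          then show False using j(1) \<open>\<not> k \<le> k'\<close> by (simp add: g_def split: if_splits)
        qed
      qed
      then show ?thesis using Suc iff by (simp add: g_def)
    qed
    then show ?thesis using y yM by blast
  qed
  have inj: "inj_on g M"
  proof (rule inj_onI, rule ccontr)
    fix y y' assume y: "y \<in> M" "y' \<in> M" "g y = g y'" "y \<noteq> y'"
    then have "d y y' > 0" by simp
    then show False using near[of "d y y'"] y by (metis less_irrefl)
  qed
  define h where "h = inv_into M g"
  have hg: "h (g y) = y" if "y \<in> M" for y using that inj by (simp add: h_def)
  have hM: "h x \<in> M" "g (h x) = x" if "x \<in> g ` M" for x
    using that by (simp_all add: h_def inv_into_into f_inv_into_f)
  have seq: "x \<in> g ` M \<and> limitin mtopology (\<lambda>j. h (\<xi> j)) (h x) sequentially"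
    if "\<And>j. \<xi> j \<in> g ` M" "\<xi> \<longlonglongrightarrow> x" for \<xi> x
    using lim[of "\<lambda>j. h (\<xi> j)" x] that hM hg by auto
  show thesis
  proof
    show "closed (g ` M)" unfolding closed_sequential_limits using seq by blast
    show "bij_betw h (g ` M) M"
      unfolding h_def using inj by (intro bij_betw_inv_into inj_on_imp_bij_betw)
    show "continuous_map (top_of_set (g ` M)) mtopology h"
      unfolding continuous_map_closedin
    proof (intro conjI allI impI)
      show "h \<in> topspace (top_of_set (g ` M)) \<rightarrow> topspace mtopology" using hM by simp
      fix C assume C: "closedin mtopology C"
      have "closed {x \<in> g ` M. h x \<in> C}"
        unfolding closed_sequential_limits
      proof (intro allI impI)
        fix \<xi> x assume \<xi>: "(\<forall>j. \<xi> j \<in> {x \<in> g ` M. h x \<in> C}) \<and> \<xi> \<longlonglongrightarrow> x"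
        then have *: "x \<in> g ` M" "limitin mtopology (\<lambda>j. h (\<xi> j)) (h x) sequentially"
          using seq[of \<xi> x] by auto
        have "h x \<in> C" by (rule limitin_closedin[OF *(2) C]) (use \<xi> in auto)
        then show "x \<in> {x \<in> g ` M. h x \<in> C}" using *(1) by simp
      qed
      then show "closedin (top_of_set (g ` M)) {x \<in> topspace (top_of_set (g ` M)). h x \<in> C}"
        by (simp add: closed_subset)
    qed
  qed
qed

text \<open>Names for closed sets: closed balls of rational radius around dense points, complements
  of such open balls, and for \<open>Near m\<close> the empty set, whose complement is covered by
  closed balls of radius \<open>1 / (m + 1)\<close>.\<close>

datatype code = Below nat rat | Above nat rat | Near nat

instance code :: countable
  by countable_datatype

lemma Polish_space_coding:
  assumes "Polish_space X" "topspace X \<noteq> {}"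
  obtains F :: "(nat \<Rightarrow> nat) set" and h
  where "closed F" "continuous_map (top_of_set F) X h" "bij_betw h F (topspace X)"
proof -
  obtain M d where Md: "Metric_space M d" and complete: "Metric_space.mcomplete M d"
    and X: "X = Metric_space.mtopology M d"
    using assms(1) unfolding Polish_space_def completely_metrizable_space_def by blast
  interpret Metric_space M d by (rule Md)
  have top: "topspace X = M" by (simp add: X)
  obtain D where D: "countable D" "D \<subseteq> M" "X closure_of D = M"
    using assms(1) unfolding Polish_space_def separable_space_def top by blast
  then have "D \<noteq> {}" using assms(2) top by force
  define a where "a = from_nat_into D"
  have a: "a i \<in> M" for i using from_nat_into[OF \<open>D \<noteq> {}\<close>] D(2) unfolding a_def by blast
  have dense: "\<exists>i. d (a i) y < \<epsilon>" if y: "y \<in> M" and pos: "\<epsilon> > 0" for y \<epsilon>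
  proof -
    have "y \<in> mtopology closure_of D" using y D(3) X by simp
    then obtain z where z: "z \<in> D" "d y z < \<epsilon>"
      using pos unfolding metric_closure_of by auto
    obtain i where "a i = z" using from_nat_into_surj[OF D(1) z(1)] unfolding a_def by blast
    then show ?thesis using z(2) by (metis commute)
  qed
  define Z where "Z c = (case c of
      Below i q \<Rightarrow> {y\<in>M. d (a i) y \<le> of_rat q}
    | Above i q \<Rightarrow> {y\<in>M. of_rat q \<le> d (a i) y}
    | Near m \<Rightarrow> {})" for c
  \<comment> \<open>Rationals are enumerated by \<open>from_nat\<close>; one not on the required
    side of \<open>q\<close> is replaced by \<open>q + 1\<close> or \<open>q - 1\<close>, so that
    each witness set is disjoint from \<open>Z c\<close>.\<close>
  define W where "W c k = (case c of
      Below i q \<Rightarrow> Above i (if q < from_nat k then from_nat k else q + 1)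
    | Above i q \<Rightarrow> Below i (if from_nat k < q then from_nat k else q - 1)
    | Near m \<Rightarrow> Below k (1 / of_nat (Suc m)))" for c k
  have closed_Z: "closedin mtopology (Z c)" for c
  proof (cases c)
    case (Below i q)
    then have "Z c = mcball (a i) (of_rat q)" using a by (auto simp: Z_def in_mcball)
    then show ?thesis by simp
  next
    case (Above i q)
    then have "Z c = topspace mtopology - mball (a i) (of_rat q)" using a by (auto simp: Z_def in_mball)
    then show ?thesis by (simp add: closedin_diff)
  qed (simp add: Z_def)
  have cover: "M \<subseteq> Z c \<union> (\<Union>k. Z (W c k))" for c
  proof
    fix y assume y: "y \<in> M"
    show "y \<in> Z c \<union> (\<Union>k. Z (W c k))"
    proof (cases c)
      case (Below i q)
      show ?thesis
      proof (cases "y \<in> Z c")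
        case False
        then have "of_rat q < d (a i) y" using y Below by (simp add: Z_def)
        then obtain r where r: "of_rat q < real_of_rat r" "real_of_rat r < d (a i) y"
          using of_rat_dense by blast
        then have "y \<in> Z (W c (to_nat r))" using y Below by (simp add: Z_def W_def of_rat_less)
        then show ?thesis by blast
      qed simp
    next
      case (Above i q)
      show ?thesis
      proof (cases "y \<in> Z c")
        case False
        then have "d (a i) y < of_rat q" using y Above by (simp add: Z_def)
        then obtain r where r: "d (a i) y < real_of_rat r" "real_of_rat r < of_rat q"
          using of_rat_dense by blast
        then have "y \<in> Z (W c (to_nat r))" using y Above by (simp add: Z_def W_def of_rat_less)
        then show ?thesis by blast
      qed simp
    next
      case (Near m)
      obtain k where "d (a k) y < 1 / of_nat (Suc m)" using dense[OF y, of "1 / of_nat (Suc m)"] by auto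
      then have "y \<in> Z (W c k)" using y Near by (simp add: Z_def W_def of_rat_divide of_rat_add)
      then show ?thesis by blast
    qed
  qed
  have disj: "Z c \<inter> Z (W c k) = {}" for c k
  proof (cases c)
    case (Below i q)
    obtain r where "q < r" "W c k = Above i r"
      by (cases "q < from_nat k") (simp_all add: Below W_def)
    moreover from this have "real_of_rat q < of_rat r" by (simp add: of_rat_less)
    ultimately show ?thesis using Below by (auto simp: Z_def)
  next
    case (Above i q)
    obtain r where "r < q" "W c k = Below i r"
      by (cases "from_nat k < q") (simp_all add: Above W_def)
    moreover from this have "real_of_rat r < of_rat q" by (simp add: of_rat_less)
    ultimately show ?thesis using Above by (auto simp: Z_def)
  qed (simp add: Z_def)
  have small: "\<exists>m. \<forall>k. \<forall>y\<in>Z (W (Near m) k). \<forall>y'\<in>Z (W (Near m) k). d y y' < \<epsilon>" if pos: "\<epsilon> > 0" for \<epsilon>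
  proof -
    obtain m where m: "1 / of_nat (Suc m) < \<epsilon> / 2"
      using nat_approx_posE[of "\<epsilon> / 2"] pos by auto
    have "d y y' < \<epsilon>" if "y \<in> Z (W (Near m) k)" "y' \<in> Z (W (Near m) k)" for k y y'
    proof -
      have le: "d (a k) y \<le> 1 / of_nat (Suc m)" "d (a k) y' \<le> 1 / of_nat (Suc m)" "y \<in> M" "y' \<in> M"
        using that by (simp_all add: Z_def W_def of_rat_divide of_rat_add)
      then have "d y y' \<le> d (a k) y + d (a k) y'"
        using triangle[OF _ a, of y y' k] by (simp add: commute)
      then show ?thesis using le(1,2) m by linarith
    qed
    then show ?thesis by blast
  qed
  show thesis
  proof (rule ex_coding[of "\<lambda>n. Z (from_nat n)" "\<lambda>n k. to_nat (W (from_nat n) k)"])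
    fix \<epsilon> :: real assume "\<epsilon> > 0"
    then obtain m where m: "\<forall>k. \<forall>y\<in>Z (W (Near m) k). \<forall>y'\<in>Z (W (Near m) k). d y y' < \<epsilon>"
      using small by blast
    show "\<exists>n. Z (from_nat n) = {} \<and>
          (\<forall>k. \<forall>y\<in>Z (from_nat (to_nat (W (from_nat n) k))).
            \<forall>y'\<in>Z (from_nat (to_nat (W (from_nat n) k))). d y y' < \<epsilon>)"
      by (rule exI[of _ "to_nat (Near m)"]) (use m in \<open>simp add: Z_def[of "Near m"]\<close>)
  next
    fix F :: "(nat \<Rightarrow> nat) set" and h
    assume "closed F" "continuous_map (top_of_set F) mtopology h" "bij_betw h F M"
    then show thesis using that[of F h] X top by simp
  qed (use complete closed_Z cover disj in simp_all)
qed

subsection \<open>Refining partitions of cardinality \<open>\<kappa>\<close>\<close>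

lemma card_of_disjoint_sets_le:
  assumes "disjoint P" and R: "\<And>p. p \<in> P \<Longrightarrow> \<exists>r\<in>R. r \<noteq> {} \<and> r \<subseteq> p"
  shows "|P| \<le>o |R|"
proof -
  obtain f where f: "\<And>p. p \<in> P \<Longrightarrow> f p \<in> R \<and> f p \<noteq> {} \<and> f p \<subseteq> p"
    using R by metis
  have "inj_on f P"
  proof (rule inj_onI, rule ccontr)
    fix p q assume pq: "p \<in> P" "q \<in> P" "f p = f q" "p \<noteq> q"
    then have "p \<inter> q = {}" using assms(1) by (simp add: disjoint_def)
    then show False using f[OF pq(1)] f[OF pq(2)] pq(3) by auto
  qed
  then show ?thesis by (rule card_of_ordLeqI) (use f in blast)
qed

lemma partition_on_UN_refinement:
  assumes P: "partition_on A P" and R: "\<And>p. p \<in> P \<Longrightarrow> partition_on p (R p)"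
  shows "partition_on A (\<Union>p\<in>P. R p)"
proof (rule partition_onI)
  show "\<Union> (\<Union>p\<in>P. R p) = A"
  proof -
    have "\<Union> (\<Union>p\<in>P. R p) = (\<Union>p\<in>P. \<Union> (R p))" by blast
    also have "\<dots> = (\<Union>p\<in>P. p)" by (intro SUP_cong refl partition_onD1[OF R, symmetric])
    finally show ?thesis using partition_onD1[OF P] by simp
  qed
  show "{} \<notin> (\<Union>p\<in>P. R p)" using partition_onD3[OF R] by auto
  fix r s assume "r \<in> (\<Union>p\<in>P. R p)" "s \<in> (\<Union>p\<in>P. R p)" and neq: "r \<noteq> s"
  then obtain p q where pq: "p \<in> P" "q \<in> P" "r \<in> R p" "s \<in> R q" by blast
  show "disjnt r s"
  proof (cases "p = q")
    case True
    then show ?thesis using partition_onD2[OF R[OF pq(1)]] pq neq by (simp add: pairwise_def)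
  next
    case False
    then have "disjnt p q" using partition_onD2[OF P] pq by (simp add: pairwise_def)
    moreover have "r \<subseteq> p" "s \<subseteq> q"
      using partition_onD1[OF R[OF pq(1)]] partition_onD1[OF R[OF pq(2)]] pq(3,4) by blast+
    ultimately show ?thesis by (auto simp: disjnt_def)
  qed
qed

lemma partition_on_Un:
  assumes A: "partition_on A P" and B: "partition_on B Q" and "A \<inter> B = {}"
  shows "partition_on (A \<union> B) (P \<union> Q)"
proof (rule partition_onI)
  have sub: "p \<in> P \<Longrightarrow> p \<subseteq> A" "p \<in> Q \<Longrightarrow> p \<subseteq> B" for p
    using partition_onD1[OF A] partition_onD1[OF B] by blast+
  show "\<Union> (P \<union> Q) = A \<union> B" using partition_onD1[OF A] partition_onD1[OF B] by blast
  show "{} \<notin> P \<union> Q" using partition_onD3[OF A] partition_onD3[OF B] by blast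
  show "disjnt p q" if "p \<in> P \<union> Q" "q \<in> P \<union> Q" "p \<noteq> q" for p q
    using that sub[of p] sub[of q] assms(3) pairwiseD[OF partition_onD2[OF A], of p q]
      pairwiseD[OF partition_onD2[OF B], of p q]
    unfolding disjnt_def by blast
qed

text \<open>An infinite cardinal absorbs a union of at most \<open>\<kappa>\<close> sets of size at
  most \<open>\<kappa>\<close>; conversely, each old piece contains a new one.\<close>

lemma card_of_UN_refinement:
  fixes \<kappa> :: "'k rel"
  assumes \<kappa>: "Card_order \<kappa>" "natLeq \<le>o \<kappa>"
    and P: "partition_on A P" "|P| =o \<kappa>"
    and R: "\<And>p. p \<in> P \<Longrightarrow> partition_on p (R p)" "\<And>p. p \<in> P \<Longrightarrow> |R p| \<le>o \<kappa>"
  shows "|\<Union>p\<in>P. R p| =o \<kappa>"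
proof -
  have inf: "Cinfinite \<kappa>"
    using \<kappa> natLeq_Cinfinite cinfinite_mono by blast
  have "|\<Union>p\<in>P. R p| \<le>o \<kappa>"
    using ordIso_imp_ordLeq[OF P(2)] R(2) inf by (intro UNION_Cinfinite_bound) auto
  moreover have "|P| \<le>o |\<Union>p\<in>P. R p|"
  proof (rule card_of_disjoint_sets_le[OF partition_onD2[OF P(1)]])
    fix p assume p: "p \<in> P"
    then obtain x where x: "x \<in> p" using partition_onD3[OF P(1)] by fastforce
    then obtain r where "r \<in> R p" "x \<in> r" using partition_onD1[OF R(1)[OF p]] by blast
    then show "\<exists>r\<in>\<Union>p\<in>P. R p. r \<noteq> {} \<and> r \<subseteq> p"
      using p partition_onD1[OF R(1)[OF p]] by (intro bexI[of _ r]) auto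
  qed
  then have "\<kappa> \<le>o |\<Union>p\<in>P. R p|"
    using P(2) ordIso_symmetric ordIso_ordLeq_trans by blast
  ultimately show ?thesis by (simp add: ordIso_iff_ordLeq)
qed

lemma card_of_Un_countable:
  fixes \<kappa> :: "'k rel"
  assumes "Card_order \<kappa>" "natLeq \<le>o \<kappa>" "|P| =o \<kappa>" "countable C"
  shows "|P \<union> C| =o \<kappa>"
proof -
  have inf: "Cinfinite \<kappa>"
    using assms(1,2) natLeq_Cinfinite cinfinite_mono by blast
  have "|C| \<le>o \<kappa>"
    using assms(2,4) countable_card_le_natLeq ordLeq_transitive by blast
  then have "|P \<union> C| \<le>o \<kappa>"
    using ordIso_imp_ordLeq[OF assms(3)] inf by (intro Un_Cinfinite_bound)
  moreover have "\<kappa> \<le>o |P \<union> C|"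
    using ordIso_ordLeq_trans[OF ordIso_symmetric[OF assms(3)] card_of_mono1[of P "P \<union> C"]] by simp
  ultimately show ?thesis by (simp add: ordIso_iff_ordLeq)
qed

lemma uncountable_if_ordIso:
  fixes \<kappa> :: "'k rel"
  assumes "natLeq <o \<kappa>" "|P| =o \<kappa>"
  shows "uncountable P"
proof
  assume "countable P"
  then have "|P| \<le>o natLeq" by (simp add: countable_card_le_natLeq)
  then have "\<kappa> \<le>o natLeq" by (rule ordIso_ordLeq_trans[OF ordIso_symmetric[OF assms(2)]])
  then show False using not_ordLess_ordLeq[OF assms(1)] by simp
qed

lemma partition_on_image_inj:
  assumes P: "partition_on A P" and f: "inj_on f A"
  shows "partition_on (f ` A) ((`) f ` P)" "|(`) f ` P| =o |P|"
proof -
  have "(`) f ` P - {{}} = (`) f ` P" using partition_onD3[OF P] by auto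
  then show "partition_on (f ` A) ((`) f ` P)" using partition_on_inj_image[OF P f] by simp
  have "inj_on ((`) f) P" using f partition_onD1[OF P] by (intro inj_on_image) simp
  then show "|(`) f ` P| =o |P|"
    by (rule ordIso_symmetric[OF card_of_ordIsoI[OF inj_on_imp_bij_betw]])
qed

text \<open>By surjectivity each piece is the image of its preimage, so preimages are nonempty and
  distinct for distinct pieces.\<close>

lemma partition_on_vimage_surj:
  assumes P: "partition_on A P" and f: "f ` F = A"
  shows "partition_on F ((\<lambda>p. {x\<in>F. f x \<in> p}) ` P)" "|(\<lambda>p. {x\<in>F. f x \<in> p}) ` P| =o |P|"
proof -
  let ?g = "\<lambda>p. {x\<in>F. f x \<in> p}"
  have img: "f ` ?g p = p" if "p \<in> P" for p
  proof -
    have "p \<subseteq> f ` F" using that partition_onD1[OF P] f by blast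
    then show ?thesis by blast
  qed
  show "partition_on F (?g ` P)"
  proof (rule partition_onI)
    show "\<Union> (?g ` P) = F" using partition_onD1[OF P] f by blast
    show "{} \<notin> ?g ` P"
    proof
      assume "{} \<in> ?g ` P"
      then obtain p where "p \<in> P" "?g p = {}" by auto
      moreover from this have "p = {}" using img[of p] by (simp only: image_empty)
      ultimately show False using partition_onD3[OF P] by simp
    qed
    fix r s assume "r \<in> ?g ` P" "s \<in> ?g ` P" "r \<noteq> s"
    then obtain p q where pq: "p \<in> P" "q \<in> P" "p \<noteq> q" "r = ?g p" "s = ?g q" by blast
    then have "p \<inter> q = {}" using partition_onD2[OF P] by (simp add: disjoint_def)
    then show "disjnt r s" using pq by (auto simp: disjnt_def)
  qed
  have "inj_on ?g P" by (rule inj_onI) (metis img)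
  then show "|?g ` P| =o |P|"
    by (rule ordIso_symmetric[OF card_of_ordIsoI[OF inj_on_imp_bij_betw]])
qed

lemma fsigma_in_vimage:
  assumes F: "closed F" and h: "continuous_map (top_of_set F) X h" and S: "fsigma_in X S"
  shows "fsigma_in euclidean {x\<in>F. h x \<in> S}"
proof -
  obtain C :: "nat \<Rightarrow> _" where C: "\<forall>n. closedin X (C n)" and S: "(\<Union>n. C n) = S"
    using S unfolding fsigma_in_ascending by blast
  have "closedin (top_of_set F) {x\<in>topspace (top_of_set F). h x \<in> C n}" for n
    using closedin_continuous_map_preimage[OF h] C by blast
  then have "closed {x\<in>F. h x \<in> C n}" for n
    using F closedin_closed_trans[of F "{x\<in>F. h x \<in> C n}"] by simp
  then have "fsigma_in euclidean (\<Union>n. {x\<in>F. h x \<in> C n})"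
    by (intro fsigma_in_Union) (auto intro!: closed_imp_fsigma_in)
  moreover have "(\<Union>n. {x\<in>F. h x \<in> C n}) = {x\<in>F. h x \<in> S}" using S by blast
  ultimately show ?thesis by simp
qed

subsection \<open>Transfer between Polish spaces\<close>

lemma Baire_partition_closed:
  fixes \<kappa> :: "'k rel"
  assumes \<kappa>: "Card_order \<kappa>" "natLeq <o \<kappa>"
    and X: "Polish_space X" "topspace X \<noteq> {}"
    and P: "partition_on (topspace X) P" "|P| =o \<kappa>" "\<And>S. S \<in> P \<Longrightarrow> fsigma_in X S"
  obtains P' where "partition_on (UNIV :: (nat \<Rightarrow> nat) set) P'" "|P'| =o \<kappa>" "\<And>C. C \<in> P' \<Longrightarrow> closed C"
proof -
  have \<kappa>': "natLeq \<le>o \<kappa>" using \<kappa>(2) by (rule ordLess_imp_ordLeq)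
  obtain F :: "(nat \<Rightarrow> nat) set" and h
    where F: "closed F" and h: "continuous_map (top_of_set F) X h" "bij_betw h F (topspace X)"
    using Polish_space_coding[OF X] .
  let ?P1 = "(\<lambda>p. {x\<in>F. h x \<in> p}) ` P"
  have P1: "partition_on F ?P1" "|?P1| =o \<kappa>"
    using partition_on_vimage_surj[OF P(1) bij_betw_imp_surj_on[OF h(2)]] P(2) ordIso_transitive by blast+
  \<comment> \<open>\<open>F\<close> may be a proper subset, so its complement joins as one extra
    piece, F-sigma because it is open; it is discarded when empty.\<close>
  define P2 where "P2 = ?P1 \<union> ({- F} - {{}})"
  have P2: "partition_on UNIV P2"
  proof -
    have "partition_on (- F) ({- F} - {{}})"
      by (auto simp: partition_on_def disjoint_def)
    then show ?thesis
      using partition_on_Un[OF P1(1), of "- F"] unfolding P2_def by simp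
  qed
  have card_P2: "|P2| =o \<kappa>"
    unfolding P2_def by (rule card_of_Un_countable[OF \<kappa>(1) \<kappa>' P1(2)]) simp
  have fs: "fsigma_in euclidean p" if "p \<in> P2" for p
  proof (cases "p \<in> ?P1")
    case True
    then show ?thesis using fsigma_in_vimage[OF F h(1)] P(3) by auto
  next
    case False
    then have "p = - F" using that unfolding P2_def by simp
    then show ?thesis using open_imp_fsigma_Baire[of "- F"] F by (simp add: open_Compl)
  qed
  have "\<exists>R. countable R \<and> partition_on p R \<and> (\<forall>C\<in>R. closed C)" if "p \<in> P2" for p
    using fsigma_partition_closed[OF fs[OF that]] by metis
  then obtain R where R: "\<And>p. p \<in> P2 \<Longrightarrow> countable (R p)" "\<And>p. p \<in> P2 \<Longrightarrow> partition_on p (R p)"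
    "\<And>p C. p \<in> P2 \<Longrightarrow> C \<in> R p \<Longrightarrow> closed C" by metis
  have "|R p| \<le>o \<kappa>" if "p \<in> P2" for p
    using R(1)[OF that] by (intro ordLeq_transitive[OF _ \<kappa>']) (simp add: countable_card_le_natLeq)
  then have "|\<Union>p\<in>P2. R p| =o \<kappa>"
    by (intro card_of_UN_refinement[OF \<kappa>(1) \<kappa>' P2 card_P2 R(2)])
  moreover have "partition_on UNIV (\<Union>p\<in>P2. R p)"
    by (rule partition_on_UN_refinement[OF P2 R(2)])
  ultimately show thesis using R(3) by (intro that[of "\<Union>p\<in>P2. R p"]) auto
qed

text \<open>A closed set meets a compact one in a compact set. \<open>P\<close> already supplies
  \<open>\<kappa>\<close> pieces, so a \<open>Q\<close> of size at most \<open>\<kappa>\<close>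
  leaves the count unchanged.\<close>

lemma partition_closed_refine_compact:
  fixes \<kappa> :: "'k rel" and P Q :: "(nat \<Rightarrow> nat) set set"
  assumes \<kappa>: "Card_order \<kappa>" "natLeq \<le>o \<kappa>"
    and P: "partition_on S P" "|P| =o \<kappa>" "\<And>C. C \<in> P \<Longrightarrow> closed C"
    and Q: "partition_on UNIV Q" "|Q| \<le>o \<kappa>" "\<And>C. C \<in> Q \<Longrightarrow> compact C"
  obtains P' where "partition_on S P'" "|P'| =o \<kappa>" "\<And>C. C \<in> P' \<Longrightarrow> compact C"
proof -
  define R where "R p = (\<inter>) p ` Q - {{}}" for p
  have part: "partition_on p (R p)" for p
    using partition_on_restrict[OF Q(1), of p] by (simp add: R_def)
  have "|R p| \<le>o |Q|" for p
    unfolding R_def using ordLeq_transitive[OF card_of_mono1[OF Diff_subset] card_of_image] .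
  then have "|R p| \<le>o \<kappa>" for p by (rule ordLeq_transitive[OF _ Q(2)])
  then have "|\<Union>p\<in>P. R p| =o \<kappa>"
    by (intro card_of_UN_refinement[OF \<kappa> P(1,2) part])
  moreover have "partition_on S (\<Union>p\<in>P. R p)"
    by (rule partition_on_UN_refinement[OF P(1) part])
  moreover have "compact C" if "C \<in> (\<Union>p\<in>P. R p)" for C
    using that P(3) Q(3) closed_Int_compact unfolding R_def by auto
  ultimately show thesis using that by blast
qed

lemma Baire_partition_compact:
  fixes \<kappa> :: "'k rel" and P :: "(nat \<Rightarrow> nat) set set"
  assumes \<kappa>: "Card_order \<kappa>" "natLeq <o \<kappa>"
    and P: "partition_on UNIV P" "|P| =o \<kappa>" "\<And>C. C \<in> P \<Longrightarrow> closed C"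
  obtains Q where "partition_on (UNIV :: (nat \<Rightarrow> nat) set) Q" "|Q| =o \<kappa>" "\<And>C. C \<in> Q \<Longrightarrow> compact C"
proof -
  have \<kappa>': "natLeq \<le>o \<kappa>" using \<kappa>(2) by (rule ordLess_imp_ordLeq)
  obtain \<phi> :: "(nat \<Rightarrow> nat) \<Rightarrow> nat \<Rightarrow> nat" where \<phi>: "\<And>p. p \<in> P \<Longrightarrow> compact (\<phi> -` p)"
    using ex_condensing_embedding[OF closed_UNIV P(1,3) uncountable_if_ordIso[OF \<kappa>(2) P(2)]] by metis
  \<comment> \<open>Pieces that miss the range of \<open>\<phi>\<close> have empty preimage and are
    dropped, so only an upper bound on the number survives; the final refinement restores
    equality.\<close>
  define Q where "Q = (-`) \<phi> ` P - {{}}"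
  have "|Q| \<le>o |P|"
    unfolding Q_def using ordLeq_transitive[OF card_of_mono1[OF Diff_subset] card_of_image] .
  then have "|Q| \<le>o \<kappa>" by (rule ordLeq_ordIso_trans[OF _ P(2)])
  moreover have "partition_on UNIV Q"
    using partition_on_vimage[OF P(1), of \<phi>] by (simp add: Q_def)
  moreover have "compact C" if "C \<in> Q" for C using that \<phi> by (auto simp: Q_def)
  ultimately show thesis
    using partition_closed_refine_compact[OF \<kappa>(1) \<kappa>' P, of Q] that by metis
qed

lemma Polish_space_partition_compact:
  fixes \<kappa> :: "'k rel" and Q :: "(nat \<Rightarrow> nat) set set"
  assumes \<kappa>: "Card_order \<kappa>" "natLeq <o \<kappa>"
    and Q: "partition_on UNIV Q" "|Q| =o \<kappa>" "\<And>C. C \<in> Q \<Longrightarrow> compact C"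
    and Y: "Polish_space Y" "uncountable (topspace Y)"
  shows "can_be_partitioned Y \<kappa> Compact"
proof -
  have \<kappa>': "natLeq \<le>o \<kappa>" using \<kappa>(2) by (rule ordLess_imp_ordLeq)
  have "topspace Y \<noteq> {}" using Y(2) by auto
  then obtain F :: "(nat \<Rightarrow> nat) set" and h
    where F: "closed F" and h: "continuous_map (top_of_set F) Y h" "bij_betw h F (topspace Y)"
    using Polish_space_coding[OF Y(1)] by metis
  have unc: "uncountable ((\<lambda>x. {x}) ` F)"
  proof
    assume "countable ((\<lambda>x. {x}) ` F)"
    then have "countable F" by (rule countable_image_inj_on) simp
    then show False using Y(2) h(2) by (metis bij_betw_imp_surj_on countable_image)
  qed
  have sing: "closed p" if "p \<in> (\<lambda>x. {x}) ` F" for p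
    using that by (auto intro: compact_imp_closed_Baire)
  \<comment> \<open>With points as pieces, the small subsets of \<open>F\<close> are the countable
    ones, and the tree consists of condensation points of \<open>F\<close>.\<close>
  obtain \<phi> :: "(nat \<Rightarrow> nat) \<Rightarrow> nat \<Rightarrow> nat" where \<phi>: "continuous_on UNIV \<phi>" "inj \<phi>"
    "range \<phi> \<subseteq> F" "fsigma_in euclidean (F - range \<phi>)"
    by (rule ex_condensing_embedding[OF F partition_on_singletons sing unc])
  obtain \<C> where \<C>: "countable \<C>" "partition_on (F - range \<phi>) \<C>" "\<And>C. C \<in> \<C> \<Longrightarrow> closed C"
    by (rule fsigma_partition_closed[OF \<phi>(4)]) blast
  define P where "P = (`) \<phi> ` Q \<union> \<C>"
  note img = partition_on_image_inj[OF Q(1) \<phi>(2)]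
  have "partition_on F P"
    using partition_on_Un[OF img(1) \<C>(2)] \<phi>(3) unfolding P_def by (simp add: Un_absorb1)
  moreover have "|P| =o \<kappa>"
    unfolding P_def
    by (rule card_of_Un_countable[OF \<kappa>(1) \<kappa>' ordIso_transitive[OF img(2) Q(2)] \<C>(1)])
  moreover have "closed C" if C: "C \<in> P" for C
  proof (cases "C \<in> \<C>")
    case False
    then obtain q where q: "q \<in> Q" "C = \<phi> ` q" using C unfolding P_def by blast
    have "compact (\<phi> ` q)"
      by (rule compact_continuous_image[OF continuous_on_subset[OF \<phi>(1) subset_UNIV] Q(3)[OF q(1)]])
    then show ?thesis unfolding q(2) by (rule compact_imp_closed_Baire)
  qed (rule \<C>(3))
  \<comment> \<open>The members of \<open>\<C>\<close> are only known to be closed, so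
    \<open>Q\<close> is used a second time to cut all pieces into compact ones.\<close>
  ultimately obtain P' where P': "partition_on F P'" "|P'| =o \<kappa>" "\<And>C. C \<in> P' \<Longrightarrow> compact C"
    using partition_closed_refine_compact[OF \<kappa>(1) \<kappa>', of F P Q] Q ordIso_imp_ordLeq[OF Q(2)] by metis
  note img' = partition_on_image_inj[OF P'(1) bij_betw_imp_inj_on[OF h(2)]]
  \<comment> \<open>A continuous bijection preserves compactness but in general not closedness of
    sets, so the passage to compact pieces precedes this transfer.\<close>
  have "compactin Y (h ` p)" if "p \<in> P'" for p
  proof (rule image_compactin[OF _ h(1)])
    show "compactin (top_of_set F) p"
      using that P'(3) partition_onD1[OF P'(1)] by (auto simp: compactin_subtopology)
  qed
  then show ?thesis
    unfolding can_be_partitioned_def using img' ordIso_transitive[OF img'(2) P'(2)] h(2)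
    by (intro exI[of _ "(`) h ` P'"]) (auto simp: bij_betw_imp_surj_on)
qed

text \<open>The real line is carried over along an injection. Such a space lets the universal
  statements imply the existential ones.\<close>

lemma ex_uncountable_Polish_space:
  assumes "|UNIV :: real set| \<le>o |UNIV :: 'a set|"
  shows "\<exists>X :: 'a topology. Polish_space X \<and> uncountable (topspace X)"
proof -
  obtain f :: "real \<Rightarrow> 'a" where f: "inj f"
    using assms card_of_ordLeq[of "UNIV :: real set" "UNIV :: 'a set"] by blast
  let ?X = "pullback_topology (range f) (inv f) (euclidean :: real topology)"
  have top: "topspace ?X = range f" by (simp add: topspace_pullback_topology)
  have "continuous_map ?X euclidean (id \<circ> inv f)"
    by (rule continuous_map_pullback) (rule continuous_map_id)
  moreover have "continuous_map euclidean ?X f"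
    by (rule continuous_map_pullback') (use f in \<open>auto simp: comp_def\<close>)
  ultimately have "homeomorphic_maps euclidean ?X f (inv f)"
    unfolding homeomorphic_maps_def top using f by (auto simp: f_inv_into_f)
  then have hom: "(euclidean :: real topology) homeomorphic_space ?X"
    unfolding homeomorphic_space_def by blast
  obtain D :: "real set" where D: "countable D" "\<And>T. open T \<Longrightarrow> T \<noteq> {} \<Longrightarrow> \<exists>d\<in>D. d \<in> T"
    using countable_dense_exists by metis
  have "euclidean closure_of D = UNIV"
    using D(2) unfolding closure_of_def by fastforce
  then have "separable_space (euclidean :: real topology)"
    unfolding separable_space_def using D(1) by auto
  then have "Polish_space ?X"
    unfolding Polish_space_def
    using homeomorphic_separable_space[OF hom] homeomorphic_completely_metrizable_space[OF hom]
      completely_metrizable_space_euclidean by blast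
  moreover have "uncountable (topspace ?X)"
    unfolding top using f uncountable_UNIV_real by (metis countable_image_inj_on)
  ultimately show ?thesis by blast
qed

section \<open>Comparing kinds of sets, quantifiers and carrier types\<close>

lemma can_be_partitioned_F_sigma:
  assumes "Polish_space X" "can_be_partitioned X \<kappa> \<Gamma>"
  shows "can_be_partitioned X \<kappa> F_sigma"
proof -
  have "Hausdorff_space X"
    using assms(1) unfolding Polish_space_def
    by (blast intro: completely_metrizable_imp_metrizable_space metrizable_imp_Hausdorff_space)
  then have "of_kind F_sigma X S" if "of_kind \<Gamma> X S" for S
    using that by (cases \<Gamma>) (auto intro: closed_imp_fsigma_in compactin_imp_closedin)
  then show ?thesis using assms(2) unfolding can_be_partitioned_def by blast
qed

text \<open>Polish spaces are Hausdorff, so compact sets are closed and hence F-sigma: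
  \<open>Compact\<close> is the strongest kind and \<open>F_sigma\<close> the weakest.\<close>

lemma can_be_partitioned_if_Compact:
  assumes "Polish_space X" "can_be_partitioned X \<kappa> Compact"
  shows "can_be_partitioned X \<kappa> \<Gamma>"
proof -
  have "Hausdorff_space X"
    using assms(1) unfolding Polish_space_def
    by (blast intro: completely_metrizable_imp_metrizable_space metrizable_imp_Hausdorff_space)
  then have "of_kind \<Gamma> X S" if "of_kind Compact X S" for S
    using that by (cases \<Gamma>) (auto intro: closed_imp_fsigma_in compactin_imp_closedin)
  then show ?thesis using assms(2) unfolding can_be_partitioned_def by blast
qed

text \<open>Either quantifier provides one uncountable space with an F-sigma partition, the weakest
  premise; this yields compact partitions of all uncountable Polish spaces on the second type, the
  strongest conclusion.\<close>

lemma partition_statement_imp: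
  fixes \<kappa> :: "'k rel"
  assumes \<kappa>: "Card_order \<kappa>" "natLeq <o \<kappa>"
    and a: "|UNIV :: real set| \<le>o |UNIV :: 'a set|"
    and b: "|UNIV :: real set| \<le>o |UNIV :: 'b set|"
    and st: "partition_statement TYPE('a) \<kappa> Q \<Gamma>"
  shows "partition_statement TYPE('b) \<kappa> Q' \<Gamma>'"
proof -
  obtain X :: "'a topology" where X: "Polish_space X" "uncountable (topspace X)" "can_be_partitioned X \<kappa> \<Gamma>"
    using st ex_uncountable_Polish_space[OF a] by (cases Q) auto
  then obtain P where P: "partition_on (topspace X) P" "|P| =o \<kappa>" "\<And>S. S \<in> P \<Longrightarrow> fsigma_in X S"
    using can_be_partitioned_F_sigma[OF X(1,3)] unfolding can_be_partitioned_def by auto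
  have "topspace X \<noteq> {}" using X(2) by auto
  then obtain P' where P': "partition_on (UNIV :: (nat \<Rightarrow> nat) set) P'" "|P'| =o \<kappa>" "\<And>C. C \<in> P' \<Longrightarrow> closed C"
    using Baire_partition_closed[OF \<kappa> X(1) _ P] by metis
  show ?thesis
  proof (rule Baire_partition_compact[OF \<kappa> P'])
    fix R :: "(nat \<Rightarrow> nat) set set"
    assume R: "partition_on UNIV R" "|R| =o \<kappa>" "\<And>C. C \<in> R \<Longrightarrow> compact C"
    have "can_be_partitioned Y \<kappa> \<Gamma>'" if "Polish_space Y" "uncountable (topspace Y)" for Y :: "'b topology"
      using Polish_space_partition_compact[OF \<kappa> R that] that(1) can_be_partitioned_if_Compact by blast
    then show "partition_statement TYPE('b) \<kappa> Q' \<Gamma>'"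
      using ex_uncountable_Polish_space[OF b] by (cases Q') auto
  qed
qed

text \<open>The implication is uniform in quantifiers, kinds and carrier types, so exchanging the
  two sides gives the converse. Two separate carrier types make the truth of the statement
  independent of the type chosen.\<close>

theorem theorem2p4:
  fixes \<kappa> :: "'k rel"
    and Q Q' :: quantifier
    and \<Gamma> \<Gamma>' :: set_kind
  assumes "Card_order \<kappa>"
    and "natLeq <o \<kappa>"
    and "|UNIV :: real set| \<le>o |UNIV :: 'a set|"
    and "|UNIV :: real set| \<le>o |UNIV :: 'b set|"
  shows "partition_statement TYPE('a) \<kappa> Q \<Gamma> \<longleftrightarrow> partition_statement TYPE('b) \<kappa> Q' \<Gamma>'"
  using partition_statement_imp[OF assms] partition_statement_imp[OF assms(1,2,4,3)] by blast

end
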